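(* Let $f:\mathbb{E}\to\mathbb{R}$ be differentiable and satisfy, for constants $\mu,L>0$ and all $x,y\in\mathbb{E}$, $\langle\nabla f(x)-\nabla f(y),x-y\rangle\ge\mu\|x-y\|^2$ and $\|\nabla f(x)-\nabla f(y)\|_*\le L\|x-y\|$. Let $f_*=\min f$ and $\kappa=L/\mu$. Let $(x_k,H_k,d_k,h_k)_{k\ge0}$ be generated by the BFGS method (see context) from $x_0\in\mathbb{E}$ and a positive definite $H_0:\mathbb{E}^*\to\mathbb{E}$, and suppose that for some constant $\eta>0$ the step sizes are such that, for every $k\ge0$, $$f(x_k)-f(x_{k+1})\ge\eta\,\frac{\langle\nabla f(x_k),d_k\rangle^2}{L\|d_k\|^2}.$$ Then, for all $k\ge1$, $$f(x_k)-f_*\le(1-2\eta\kappa^{-2}\zeta_k)^k\,[f(x_0)-f_*],\qquad \zeta_k:=\exp(-\psi_0/k),$$ where $\psi_0:=\psi(LB,H_0^{-1})$.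
   Context: $\mathbb{E}$ is a real vector space of finite dimension $n\ge1$, $\mathbb{E}^*$ its dual, $\langle s,x\rangle$ the value of $s\in\mathbb{E}^*$ at $x\in\mathbb{E}$. $B:\mathbb{E}\to\mathbb{E}^*$ is a fixed self-adjoint positive definite operator; $\|u\|=\langle Bu,u\rangle^{1/2}$, $\|s\|_*=\langle s,B^{-1}s\rangle^{1/2}$. For self-adjoint positive definite $X,Y:\mathbb{E}\to\mathbb{E}^*$, $\psi(X,Y):=\operatorname{Tr}(X^{-1}(Y-X))-\ln\det(X^{-1}Y)\ (\ge0)$. BFGS method: given $x_0$ and self-adjoint positive definite $H_0:\mathbb{E}^*\to\mathbb{E}$, for $k\ge0$: $d_k=H_k\nabla f(x_k)$; choose a step size $h_k>0$; $x_{k+1}=x_k-h_kd_k$; $\delta_k=x_{k+1}-x_k$, $\gamma_k=\nabla f(x_{k+1})-\nabla f(x_k)$; $$H_{k+1}=H_k-\frac{H_k\gamma_k\delta_k^*+\delta_k\gamma_k^*H_k}{\langle\gamma_k,\delta_k\rangle}+\Bigl(\frac{\langle\gamma_k,H_k\gamma_k\rangle}{\langle\gamma_k,\delta_k\rangle}+1\Bigr)\frac{\delta_k\delta_k^*}{\langle\gamma_k,\delta_k\rangle},$$ where, e.g., $(\delta\delta^* )s=\langle s,\delta\rangle\delta$ and $(H\gamma\delta^* )s=\langle s,\delta\rangle H\gamma$. Equivalently, $G_k:=H_k^{-1}$ satisfies $G_{k+1}=G_k-\frac{G_k\delta_k\delta_k^*G_k}{\langle G_k\delta_k,\delta_k\rangle}+\frac{\gamma_k\gamma_k^*}{\langle\gamma_k,\delta_k\rangle}$.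 Standing assumption: $\langle\gamma_k,\delta_k\rangle>0$ for all $k\ge0$ (otherwise the method has already found the minimizer). All $H_k$ are then positive definite. *)

theory Defs
  imports "HOL-Analysis.Analysis"
begin

text \<open>
  The space \<open>E\<close> is a type \<open>'a\<close> of class \<^class>\<open>euclidean_space\<close> (real, of finite dimension
  \<open>n \<ge> 1\<close>), and its dual is the type \<open>'a \<Rightarrow>\<^sub>L real\<close> of bounded linear functionals, which in
  finite dimension are all the linear ones.  The inner product that comes with the class only
  provides the topology of \<open>E\<close> and a basis for writing down matrices; all geometric quantities below
  refer to the operator \<open>B\<close>.
\<close>

type_synonym 'a dual = "'a \<Rightarrow>\<^sub>L real"

abbreviation pairing :: "'a::euclidean_space dual \<Rightarrow> 'a \<Rightarrow> real"  (\<open>\<langle>_,/ _\<rangle>\<close>)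
  where "\<langle>s, x\<rangle> \<equiv> blinfun_apply s x"

definition self_adjoint_pos_def :: "('a::euclidean_space \<Rightarrow> 'a dual) \<Rightarrow> bool"
  where "self_adjoint_pos_def A \<longleftrightarrow>
    linear A \<and> (\<forall>u v. \<langle>A u, v\<rangle> = \<langle>A v, u\<rangle>) \<and> (\<forall>u. u \<noteq> 0 \<longrightarrow> \<langle>A u, u\<rangle> > 0)"

definition self_adjoint_pos_def_dual :: "('a::euclidean_space dual \<Rightarrow> 'a) \<Rightarrow> bool"
  where "self_adjoint_pos_def_dual H \<longleftrightarrow>
    linear H \<and> (\<forall>s t. \<langle>s, H t\<rangle> = \<langle>t, H s\<rangle>) \<and> (\<forall>s. s \<noteq> 0 \<longrightarrow> \<langle>s, H s\<rangle> > 0)"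

definition normB :: "('a::euclidean_space \<Rightarrow> 'a dual) \<Rightarrow> 'a \<Rightarrow> real"
  where "normB B u = sqrt \<langle>B u, u\<rangle>"

definition dual_normB :: "('a::euclidean_space \<Rightarrow> 'a dual) \<Rightarrow> 'a dual \<Rightarrow> real"
  where "dual_normB B s = sqrt \<langle>s, inv B s\<rangle>"

text \<open>The gradient as an element of the dual space; meaningful where \<open>f\<close> is differentiable.\<close>

definition grad :: "('a::euclidean_space \<Rightarrow> real) \<Rightarrow> 'a \<Rightarrow> 'a dual"
  where "grad f x = Blinfun (frechet_derivative f (at x))"

text \<open>
  Trace and determinant of an endomorphism of \<open>E\<close> are those of its matrix with respect to
  \<^const>\<open>Basis\<close>.  Matrices in \<open>HOL-Analysis\<close> are indexed by finite types, so
  \<^const>\<open>Basis\<close> is turned into a type first.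
\<close>

typedef (overloaded) ('a::euclidean_space) basis_index = "Basis :: 'a set"
  by (rule nonempty_Basis[unfolded ex_in_conv[symmetric]])

instance basis_index :: (euclidean_space) finite
proof
  have "finite (range (Rep_basis_index :: 'a basis_index \<Rightarrow> 'a))"
    by (rule finite_subset[OF _ finite_Basis]) (use Rep_basis_index in blast)
  then show "finite (UNIV :: 'a basis_index set)"
    by (rule finite_imageD) (simp add: inj_on_def Rep_basis_index_inject)
qed

definition op_matrix ::
    "('a::euclidean_space \<Rightarrow> 'a) \<Rightarrow> real ^ 'a basis_index ^ 'a basis_index"
  where "op_matrix T = (\<chi> i j. T (Rep_basis_index j) \<bullet> Rep_basis_index i)"

definition op_trace :: "('a::euclidean_space \<Rightarrow> 'a) \<Rightarrow> real"
  where "op_trace T = trace (op_matrix T)"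

definition op_det :: "('a::euclidean_space \<Rightarrow> 'a) \<Rightarrow> real"
  where "op_det T = det (op_matrix T)"

definition psi :: "('a::euclidean_space \<Rightarrow> 'a dual) \<Rightarrow> ('a \<Rightarrow> 'a dual) \<Rightarrow> real"
  where "psi X Y = op_trace (\<lambda>u. inv X (Y u - X u)) - ln (op_det (\<lambda>u. inv X (Y u)))"

definition bfgs_update ::
    "('a::euclidean_space dual \<Rightarrow> 'a) \<Rightarrow> 'a \<Rightarrow> 'a dual \<Rightarrow> 'a dual \<Rightarrow> 'a"
  where "bfgs_update H \<delta> \<gamma> = (\<lambda>s.
    H s - (1 / \<langle>\<gamma>, \<delta>\<rangle>) *\<^sub>R (\<langle>s, \<delta>\<rangle> *\<^sub>R H \<gamma> + \<langle>\<gamma>, H s\<rangle> *\<^sub>R \<delta>)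
        + ((\<langle>\<gamma>, H \<gamma>\<rangle> / \<langle>\<gamma>, \<delta>\<rangle> + 1) / \<langle>\<gamma>, \<delta>\<rangle>) *\<^sub>R (\<langle>s, \<delta>\<rangle> *\<^sub>R \<delta>))"

text \<open>
  The sequences \<open>x\<close>, \<open>H\<close>, \<open>d\<close>, \<open>h\<close> are generated by the BFGS method.  The curvature condition
  \<open>\<langle>\<gamma>\<^sub>k, \<delta>\<^sub>k\<rangle> > 0\<close> is the standing assumption that the method has not terminated; positive
  definiteness is required of \<open>H 0\<close> only.
\<close>

definition bfgs_method ::
    "('a::euclidean_space \<Rightarrow> real) \<Rightarrow> (nat \<Rightarrow> 'a) \<Rightarrow> (nat \<Rightarrow> 'a dual \<Rightarrow> 'a) \<Rightarrow>
     (nat \<Rightarrow> 'a) \<Rightarrow> (nat \<Rightarrow> real) \<Rightarrow> bool"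
  where "bfgs_method f x H d h \<longleftrightarrow>
    self_adjoint_pos_def_dual (H 0) \<and>
    (\<forall>k. d k = H k (grad f (x k)) \<and>
         h k > 0 \<and>
         x (Suc k) = x k - h k *\<^sub>R d k \<and>
         (let \<delta> = x (Suc k) - x k; \<gamma> = grad f (x (Suc k)) - grad f (x k)
          in \<langle>\<gamma>, \<delta>\<rangle> > 0 \<and> H (Suc k) = bfgs_update (H k) \<delta> \<gamma>))"

end

theory Submission
  imports Defs
begin

text \<open>
  The potential \<open>psi X G\<^sub>k\<close> with \<open>X = L B\<close> and \<open>G\<^sub>k\<close> the inverse of \<open>H\<^sub>k\<close> is nonnegative.  Since the trace and the determinant of
  \<open>X\<^sup>-\<^sup>1 G\<^sub>k\<close> change explicitly under an update, cocoercivity and strong monotonicity of the gradient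
  show that each step lowers it by at least \<open>ln (1 / (\<kappa> q\<^sub>k))\<close>, where \<open>q\<^sub>k\<close> is the squared cosine of the
  angle between the search direction and the gradient.  Hence the geometric mean of
  \<open>q\<^sub>0, \<dots>, q\<^sub>k\<^sub>-\<^sub>1\<close> is at least \<open>\<zeta>\<^sub>k / \<kappa>\<close>.  The step size condition and gradient dominance give a decrease
  of \<open>f - f\<^sub>*\<close> by the factor \<open>1 - 2 \<eta> q\<^sub>k / \<kappa>\<close>, and the inequality of arithmetic and geometric means,
  used once for the \<open>q\<^sub>i\<close> and once for these factors, combines the two.
\<close>

subsection \<open>Trace and determinant of operators\<close>

text \<open>Cramer's rule for the identity matrix: the coordinates of \<open>s\<close> are its
  coefficients in the rows of \<open>mat 1\<close>.\<close>

lemma det_replace_row_mat_1: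
  fixes s :: "'b::field ^ 'n::finite"
  shows "det (\<chi> i. if i = k then s else axis i 1) = s $ k"
proof -
  have "(\<Sum>i\<in>UNIV. s $ i *s row i (mat 1)) = s"
    by (simp add: vec_eq_iff row_def mat_def if_distrib cong: if_cong)
  moreover have "row i (mat 1 :: 'b ^ 'n ^ 'n) = axis i 1" for i
    by (simp add: vec_eq_iff row_def mat_def axis_def)
  ultimately show ?thesis
    using cramer_lemma_transpose[of k s "mat 1 :: 'b ^ 'n ^ 'n"] by (simp cong: if_cong)
qed

text \<open>Multilinearity clears a row \<open>axis i 1 + u i *s s\<close>, because the discarded
  term has \<open>s\<close> both in row \<open>i\<close> and in row \<open>k\<close>. Once all rows
  in \<open>S\<close> are cleared, \<open>det_replace_row_mat_1\<close> applies.\<close>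

lemma det_rank_one_replace_row:
  fixes s :: "'b::field ^ 'n::finite"
  assumes "finite S" "k \<notin> S"
  shows "det (\<chi> i. if i = k then s else if i \<in> S then axis i 1 + u i *s s else axis i 1) = s $ k"
  using assms
proof (induction S rule: finite_induct)
  case empty
  then show ?case using det_replace_row_mat_1[of k s] by (simp cong: if_cong)
next
  case (insert j S)
  have jk: "j \<noteq> k" using insert.prems by auto
  let ?c = "\<lambda>i. if i = k then s else if i \<in> S then axis i 1 + u i *s s else axis i 1"
  have "det (\<chi> i. if i = k then s else if i \<in> insert j S then axis i 1 + u i *s s else axis i 1)
      = det (\<chi> i. if i = j then axis i 1 + u i *s s else ?c i)"
    using jk by (intro arg_cong[where f = det]) (auto simp: vec_eq_iff)
  also have "\<dots> = det (\<chi> i. if i = j then axis i 1 else ?c i)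
      + u j * det (\<chi> i. if i = j then s else ?c i)"
    unfolding det_row_add det_row_mul[symmetric]
    by (simp cong: if_cong)
  also have "det (\<chi> i. if i = j then s else ?c i) = 0"
    by (rule det_identical_rows[OF jk]) (use jk in \<open>auto simp: row_def vec_eq_iff\<close>)
  also have "(\<chi> i. if i = j then axis i 1 else ?c i) = (\<chi> i. ?c i)"
    using jk insert.hyps by (auto simp: vec_eq_iff)
  finally show ?case using insert by simp
qed

text \<open>Splitting the newly perturbed row \<open>k\<close> leaves the determinant for
  \<open>S\<close> plus \<open>u k\<close> times one with \<open>s\<close> alone in row
  \<open>k\<close>, which the preceding lemma evaluates. For \<open>S = UNIV\<close> this is the
  matrix determinant lemma.\<close>

lemma det_rank_one_rows:
  fixes s :: "'b::field ^ 'n::finite"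
  assumes "finite S"
  shows "det (\<chi> i. if i \<in> S then axis i 1 + u i *s s else axis i 1) = 1 + (\<Sum>i\<in>S. u i * s $ i)"
  using assms
proof (induction S rule: finite_induct)
  case empty
  have "(\<chi> i. axis i 1) = (mat 1 :: 'b ^ 'n ^ 'n)"
    by (simp add: vec_eq_iff mat_def axis_def)
  then show ?case by simp
next
  case (insert k S)
  let ?c = "\<lambda>i. if i \<in> S then axis i 1 + u i *s s else axis i 1"
  have "det (\<chi> i. if i \<in> insert k S then axis i 1 + u i *s s else axis i 1)
      = det (\<chi> i. if i = k then axis i 1 + u i *s s else ?c i)"
    by (intro arg_cong[where f = det]) (auto simp: vec_eq_iff)
  also have "\<dots> = det (\<chi> i. if i = k then axis i 1 else ?c i)
      + u k * det (\<chi> i. if i = k then s else ?c i)"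
    unfolding det_row_add det_row_mul[symmetric]
    by (simp cong: if_cong)
  also have "det (\<chi> i. if i = k then s else ?c i) = s $ k"
    by (rule det_rank_one_replace_row[OF insert.hyps])
  also have "(\<chi> i. if i = k then axis i 1 else ?c i) = (\<chi> i. ?c i)"
    using insert.hyps by (auto simp: vec_eq_iff)
  finally show ?case using insert by (simp add: algebra_simps)
qed

lemma inner_sum_basis_index:
  fixes x y :: "'a::euclidean_space"
  shows "(\<Sum>k\<in>UNIV. (x \<bullet> Rep_basis_index k) * (y \<bullet> Rep_basis_index k)) = x \<bullet> y"
proof -
  have "bij_betw (Rep_basis_index :: 'a basis_index \<Rightarrow> 'a) UNIV Basis"
    using type_definition.Rep_range[OF type_definition_basis_index]
    by (auto simp: bij_betw_def inj_on_def Rep_basis_index_inject)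
  then have "(\<Sum>k\<in>UNIV. (x \<bullet> Rep_basis_index k) * (y \<bullet> Rep_basis_index k))
      = (\<Sum>b\<in>Basis. (x \<bullet> b) * (y \<bullet> b))"
    by (rule sum.reindex_bij_betw)
  then show ?thesis by (simp add: euclidean_inner[of x y])
qed

lemma pairing_sum_basis_index:
  fixes s :: "'a::euclidean_space dual"
  shows "(\<Sum>k\<in>UNIV. (w \<bullet> Rep_basis_index k) * \<langle>s, Rep_basis_index k\<rangle>) = \<langle>s, w\<rangle>"
proof -
  \<comment> \<open>\<open>a\<close> is the Riesz vector of \<open>s\<close>, which reduces the
    claim to Parseval's identity.\<close>
  define a where "a = adjoint (blinfun_apply s) 1"
  have a: "\<langle>s, v\<rangle> = a \<bullet> v" for v
    unfolding a_def using adjoint_works[OF bounded_linear.linear[OF blinfun.bounded_linear_right], of v s 1]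
    by (simp add: inner_commute)
  show ?thesis
    unfolding a by (simp add: inner_sum_basis_index inner_commute)
qed

lemma inner_Rep_basis_index:
  "Rep_basis_index i \<bullet> Rep_basis_index j = (if i = j then 1 else 0)"
  by (simp add: inner_Basis Rep_basis_index Rep_basis_index_inject)

text \<open>The adjoint of \<open>S\<close> turns the sum over the middle index of the matrix
  product into Parseval's sum.\<close>

lemma op_det_compose:
  assumes "linear S"
  shows "op_det (\<lambda>u. S (T u)) = op_det S * op_det T"
proof -
  have adj: "S v \<bullet> w = v \<bullet> adjoint S w" for v w
    using adjoint_works[OF assms] by (simp add: inner_commute)
  have "op_matrix (\<lambda>u. S (T u)) = op_matrix S ** op_matrix T"
    unfolding op_matrix_def matrix_matrix_mult_def vec_eq_iff
    by (simp add: adj inner_commute[of "Rep_basis_index _" "adjoint S _"] inner_sum_basis_index)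
       (simp add: inner_commute)
  then show ?thesis by (simp add: op_det_def det_mul)
qed

lemma op_det_ident: "op_det (\<lambda>u. u) = 1"
proof -
  have "op_matrix (\<lambda>u::'a::euclidean_space. u) = mat 1"
    by (auto simp: op_matrix_def mat_def vec_eq_iff inner_Rep_basis_index)
  then show ?thesis by (simp add: op_det_def)
qed

lemma op_det_rank_one:
  fixes s :: "'a::euclidean_space dual"
  shows "op_det (\<lambda>u. u + \<langle>s, u\<rangle> *\<^sub>R w) = 1 + \<langle>s, w\<rangle>"
proof -
  let ?s = "(\<chi> j. \<langle>s, Rep_basis_index j\<rangle>) :: real ^ 'a basis_index"
  have "op_matrix (\<lambda>u. u + \<langle>s, u\<rangle> *\<^sub>R w)
      = (\<chi> i. if i \<in> UNIV then axis i 1 + (w \<bullet> Rep_basis_index i) *s ?s else axis i 1)"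
    by (auto simp: op_matrix_def vec_eq_iff axis_def inner_add_left inner_Rep_basis_index)
  then show ?thesis
    using det_rank_one_rows[of UNIV "\<lambda>i. w \<bullet> Rep_basis_index i" ?s]
    by (simp add: op_det_def pairing_sum_basis_index)
qed

lemma op_trace_add: "op_trace (\<lambda>u. S u + T u) = op_trace S + op_trace T"
  by (simp add: op_trace_def op_matrix_def trace_def inner_add_left sum.distrib)

lemma op_trace_rank_one:
  fixes s :: "'a::euclidean_space dual"
  shows "op_trace (\<lambda>u. \<langle>s, u\<rangle> *\<^sub>R w) = \<langle>s, w\<rangle>"
  using pairing_sum_basis_index[of w s]
  by (simp add: op_trace_def op_matrix_def trace_def mult.commute)

lemma op_trace_zero: "op_trace (\<lambda>u. 0) = 0"
  by (simp add: op_trace_def op_matrix_def trace_def)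

subsection \<open>Positive definite operators\<close>

context
  fixes A :: "'a::euclidean_space \<Rightarrow> 'a dual"
  assumes A: "self_adjoint_pos_def A"
begin

lemma spd_linear: "linear A"
  and spd_sym: "\<langle>A u, v\<rangle> = \<langle>A v, u\<rangle>"
  and spd_pos: "u \<noteq> 0 \<Longrightarrow> \<langle>A u, u\<rangle> > 0"
  using A by (auto simp: self_adjoint_pos_def_def)

lemma spd_nonneg: "\<langle>A u, u\<rangle> \<ge> 0"
  using spd_pos[of u] by (cases "u = 0") auto

text \<open>Definiteness gives injectivity. For surjectivity, \<open>A\<close> is followed by the
  Riesz map \<open>R\<close>: the composite is an injective endomorphism, hence onto, and
  injectivity of \<open>R\<close> carries this back to \<open>A\<close>.\<close>

lemma spd_bij: "bij A"
proof -
  interpret A: linear A by (rule spd_linear)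
  have inj: "inj A"
    unfolding A.inj_iff_eq_0
  proof (intro allI impI)
    fix u assume "A u = 0"
    then show "u = 0" using spd_pos[of u] by force
  qed
  define R where "R s = adjoint (blinfun_apply s) 1" for s :: "'a dual"
  have R: "R s \<bullet> v = \<langle>s, v\<rangle>" for s v
    using adjoint_works[OF bounded_linear.linear[OF blinfun.bounded_linear_right], of v s 1]
    by (simp add: R_def inner_commute)
  have "linear (\<lambda>u. R (A u))"
    by (intro linearI; rule vector_eq_ldot[THEN iffD1])
       (auto simp: inner_commute[of _ "R _"] R inner_add_right A.add A.scale blinfun.bilinear_simps
          inner_add_left)
  moreover have injR: "inj R"
    by (rule injI, rule blinfun_eqI) (metis R)
  then have "inj (\<lambda>u. R (A u))"
    using inj by (simp add: inj_def)
  ultimately have "surj (\<lambda>u. R (A u))"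
    by (rule linear_inj_imp_surj)
  have "\<exists>u. s = A u" for s
    using surjD[OF \<open>surj (\<lambda>u. R (A u))\<close>, of "R s"] injR by (auto dest: injD)
  then have "surj A" by (simp add: surj_def)
  with inj show ?thesis by (simp add: bij_def)
qed

lemma spd_inv_left: "inv A (A u) = u"
  and spd_inv_right: "A (inv A s) = s"
  using spd_bij by (simp_all add: bij_def surj_f_inv_f)

lemma spd_inv_linear: "linear (inv A)"
proof -
  interpret A: linear A by (rule spd_linear)
  show ?thesis
    by (rule linearI; metis A.add A.scale spd_inv_left spd_inv_right)
qed

lemma spd_inv_pos: "s \<noteq> 0 \<Longrightarrow> \<langle>s, inv A s\<rangle> > 0"
  by (metis blinfun.zero_right spd_inv_right spd_pos linear_0 spd_linear)

lemma spd_inv_nonneg: "\<langle>s, inv A s\<rangle> \<ge> 0"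
  using spd_inv_pos[of s] by (cases "s = 0") auto

text \<open>Completing the square along \<open>\<delta>\<close>: the right side evaluates the form
  at the \<open>A\<close>-orthogonal projection of \<open>u\<close> off \<open>\<delta>\<close>.
  Both Cauchy-Schwarz and definiteness of the updated operator follow from it.\<close>

lemma spd_deflate:
  assumes "\<delta> \<noteq> 0"
  shows "\<langle>A u, u\<rangle> - \<langle>A \<delta>, u\<rangle>\<^sup>2 / \<langle>A \<delta>, \<delta>\<rangle> =
    \<langle>A (u - (\<langle>A \<delta>, u\<rangle> / \<langle>A \<delta>, \<delta>\<rangle>) *\<^sub>R \<delta>), u - (\<langle>A \<delta>, u\<rangle> / \<langle>A \<delta>, \<delta>\<rangle>) *\<^sub>R \<delta>\<rangle>"
proof -
  interpret A: linear A by (rule spd_linear)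
  show ?thesis
    using spd_pos[OF assms] spd_sym[of u \<delta>]
    by (simp add: A.diff A.scale blinfun.bilinear_simps power2_eq_square field_simps)
qed

lemma spd_Cauchy_Schwarz: "\<langle>A u, v\<rangle>\<^sup>2 \<le> \<langle>A u, u\<rangle> * \<langle>A v, v\<rangle>"
proof (cases "u = 0")
  case True
  then show ?thesis using linear_0[OF spd_linear] by simp
next
  case False
  have "\<langle>A v, v\<rangle> - \<langle>A u, v\<rangle>\<^sup>2 / \<langle>A u, u\<rangle> \<ge> 0"
    unfolding spd_deflate[OF False] by (rule spd_nonneg)
  then show ?thesis using spd_pos[OF False] by (simp add: field_simps)
qed

lemma spd_dual_Cauchy_Schwarz: "\<langle>s, v\<rangle>\<^sup>2 \<le> \<langle>s, inv A s\<rangle> * \<langle>A v, v\<rangle>"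
  using spd_Cauchy_Schwarz[of "inv A s" v] by (simp add: spd_inv_right)

text \<open>The form attains a positive minimum on the compact unit sphere and is homogeneous of
  degree two. The bound supplies the coercivity behind \<open>minimizer_exists\<close>.\<close>

lemma spd_norm_lower: "\<exists>c>0. \<forall>u. \<langle>A u, u\<rangle> \<ge> c * (norm u)\<^sup>2"
proof -
  interpret A: linear A by (rule spd_linear)
  have "bounded_linear A" using spd_linear linear_conv_bounded_linear by blast
  then have "continuous_on (sphere 0 1) (\<lambda>u. \<langle>A u, u\<rangle>)"
    by (intro continuous_intros linear_continuous_on)
  moreover have "sphere (0::'a) 1 \<noteq> {}" by simp
  ultimately obtain w where w: "w \<in> sphere 0 1" "\<And>u. u \<in> sphere 0 1 \<Longrightarrow> \<langle>A w, w\<rangle> \<le> \<langle>A u, u\<rangle>"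
    using continuous_attains_inf[OF compact_sphere] by blast
  have "\<langle>A u, u\<rangle> \<ge> \<langle>A w, w\<rangle> * (norm u)\<^sup>2" for u
  proof (cases "u = 0")
    case False
    have "\<langle>A w, w\<rangle> \<le> \<langle>A (u /\<^sub>R norm u), u /\<^sub>R norm u\<rangle>"
      using False by (intro w) simp
    then show ?thesis
      using False by (simp add: A.scale blinfun.bilinear_simps power2_eq_square field_simps)
  qed (simp add: A.zero)
  moreover have "\<langle>A w, w\<rangle> > 0" by (rule spd_pos) (use w in auto)
  ultimately show ?thesis by blast
qed

lemma spd_scaleR: "c > 0 \<Longrightarrow> self_adjoint_pos_def (\<lambda>u. c *\<^sub>R A u)"
  using spd_linear spd_sym spd_pos
  by (auto simp: self_adjoint_pos_def_def blinfun.bilinear_simps linear_compose_scale_right)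

lemma spd_inv_scaleR:
  assumes "c > 0"
  shows "inv (\<lambda>u. c *\<^sub>R A u) s = (1 / c) *\<^sub>R inv A s"
proof -
  interpret A: linear A by (rule spd_linear)
  have "inj (\<lambda>u. c *\<^sub>R A u)"
    using assms spd_bij by (simp add: inj_def bij_def)
  then show ?thesis
    by (rule inv_f_eq) (use assms in \<open>simp add: A.scale spd_inv_right\<close>)
qed

end

text \<open>Lets the analysis run on inverse operators on the primal space. Surjectivity again comes
  from an injective endomorphism, here \<open>H\<close> after the map sending \<open>v\<close> to
  the functional \<open>blinfun_inner_left v\<close>.\<close>

lemma spd_of_dual:
  fixes H :: "'a::euclidean_space dual \<Rightarrow> 'a"
  assumes "self_adjoint_pos_def_dual H"
  shows "self_adjoint_pos_def (inv H)" "bij H"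
proof -
  interpret H: linear H using assms by (simp add: self_adjoint_pos_def_dual_def)
  have sym: "\<langle>s, H t\<rangle> = \<langle>t, H s\<rangle>" and pos: "s \<noteq> 0 \<Longrightarrow> \<langle>s, H s\<rangle> > 0" for s t
    using assms by (auto simp: self_adjoint_pos_def_dual_def)
  have inj: "inj H"
    unfolding H.inj_iff_eq_0
  proof (intro allI impI)
    fix s assume "H s = 0"
    then show "s = 0" using pos[of s] by force
  qed
  have "inj (\<lambda>v. H (blinfun_inner_left v))"
    by (intro injI) (metis inj injD blinfun_inner_left.rep_eq vector_eq_ldot)
  moreover have "linear (\<lambda>v. H (blinfun_inner_left v))"
    by (intro linear_compose[of blinfun_inner_left H, unfolded o_def] H.linear_axioms
        bounded_linear.linear[OF bounded_linear_blinfun_inner_left])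
  ultimately have "surj (\<lambda>v. H (blinfun_inner_left v))"
    by (intro linear_inj_imp_surj)
  then have "surj H" unfolding surj_def by blast
  with inj show bij: "bij H" by (simp add: bij_def)
  have r: "H (inv H u) = u" and l: "inv H (H s) = s" for u s
    using bij by (simp_all add: bij_def surj_f_inv_f)
  have "linear (inv H)"
    by (rule linearI; metis H.add H.scale r l)
  then show "self_adjoint_pos_def (inv H)"
    unfolding self_adjoint_pos_def_def
    by (metis r sym pos H.zero)
qed

subsection \<open>The BFGS update and its potential\<close>

text \<open>The update seen on the inverse operator, where it is a sum of two symmetric rank-one
  corrections whose effect on trace and determinant is explicit.\<close>

definition bfgs_inv_update ::
    "('a::euclidean_space \<Rightarrow> 'a dual) \<Rightarrow> 'a \<Rightarrow> 'a dual \<Rightarrow> 'a \<Rightarrow> 'a dual"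
  where "bfgs_inv_update G \<delta> \<gamma> = (\<lambda>u.
    G u - (\<langle>G \<delta>, u\<rangle> / \<langle>G \<delta>, \<delta>\<rangle>) *\<^sub>R G \<delta> + (\<langle>\<gamma>, u\<rangle> / \<langle>\<gamma>, \<delta>\<rangle>) *\<^sub>R \<gamma>)"

context
  fixes G :: "'a::euclidean_space \<Rightarrow> 'a dual" and \<delta> :: 'a and \<gamma> :: "'a dual"
  assumes G: "self_adjoint_pos_def G" and curv: "\<langle>\<gamma>, \<delta>\<rangle> > 0"
begin

interpretation G: linear G using G by (rule spd_linear)

lemma curvature_nonzero: "\<delta> \<noteq> 0"
  using curv by auto

lemma curvature_spd_pos: "\<langle>G \<delta>, \<delta>\<rangle> > 0"
  using G curvature_nonzero by (rule spd_pos)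

text \<open>After deflation the form is a sum of two nonnegative terms. The first vanishes only on
  multiples of \<open>\<delta>\<close>, and there the curvature condition makes the second
  positive.\<close>

lemma bfgs_inv_update_spd: "self_adjoint_pos_def (bfgs_inv_update G \<delta> \<gamma>)"
  unfolding self_adjoint_pos_def_def
proof (intro conjI allI impI)
  show "linear (bfgs_inv_update G \<delta> \<gamma>)"
    by (rule linearI)
      (simp_all add: bfgs_inv_update_def G.add G.scale blinfun.bilinear_simps algebra_simps
        add_divide_distrib)
  show "\<langle>bfgs_inv_update G \<delta> \<gamma> u, v\<rangle> = \<langle>bfgs_inv_update G \<delta> \<gamma> v, u\<rangle>" for u v
    using spd_sym[OF G, of u v] by (simp add: bfgs_inv_update_def blinfun.bilinear_simps mult.commute)
  fix u :: 'a assume "u \<noteq> 0"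
  define t where "t = \<langle>G \<delta>, u\<rangle> / \<langle>G \<delta>, \<delta>\<rangle>"
  have eq: "\<langle>bfgs_inv_update G \<delta> \<gamma> u, u\<rangle>
      = \<langle>G (u - t *\<^sub>R \<delta>), u - t *\<^sub>R \<delta>\<rangle> + \<langle>\<gamma>, u\<rangle>\<^sup>2 / \<langle>\<gamma>, \<delta>\<rangle>"
    using spd_deflate[OF G curvature_nonzero, of u]
    by (simp add: bfgs_inv_update_def blinfun.bilinear_simps t_def power2_eq_square)
  show "\<langle>bfgs_inv_update G \<delta> \<gamma> u, u\<rangle> > 0"
  proof (cases "u = t *\<^sub>R \<delta>")
    case True
    then have "t \<noteq> 0" using \<open>u \<noteq> 0\<close> by auto
    then have "\<langle>\<gamma>, u\<rangle> \<noteq> 0"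
      using curv by (subst True) (simp add: blinfun.bilinear_simps)
    then have "\<langle>\<gamma>, u\<rangle>\<^sup>2 / \<langle>\<gamma>, \<delta>\<rangle> > 0" using curv by simp
    then show ?thesis using spd_nonneg[OF G, of "u - t *\<^sub>R \<delta>"] eq by linarith
  next
    case False
    then have "\<langle>G (u - t *\<^sub>R \<delta>), u - t *\<^sub>R \<delta>\<rangle> > 0" by (intro spd_pos[OF G]) simp
    moreover have "\<langle>\<gamma>, u\<rangle>\<^sup>2 / \<langle>\<gamma>, \<delta>\<rangle> \<ge> 0" using curv by simp
    ultimately show ?thesis using eq by linarith
  qed
qed

lemma bfgs_update_inv_update:
  assumes H: "linear H" "\<And>u. H (G u) = u"
  shows "bfgs_update H \<delta> \<gamma> (bfgs_inv_update G \<delta> \<gamma> u) = u"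
proof -
  interpret H: linear H by fact
  define a c where "a = \<langle>G \<delta>, u\<rangle> / \<langle>G \<delta>, \<delta>\<rangle>" and "c = \<langle>\<gamma>, \<delta>\<rangle>"
  define b where "b = \<langle>\<gamma>, u\<rangle> / c"
  have c: "c \<noteq> 0" using curv by (simp add: c_def)
  define s where "s = bfgs_inv_update G \<delta> \<gamma> u"
  have s: "s = G u - a *\<^sub>R G \<delta> + b *\<^sub>R \<gamma>"
    by (simp add: s_def bfgs_inv_update_def a_def b_def c_def)
  have Hs: "H s = u - a *\<^sub>R \<delta> + b *\<^sub>R H \<gamma>"
    by (simp add: s H.add H.diff H.scale H(2))
  have bc: "\<langle>\<gamma>, u\<rangle> = b * c" using c by (simp add: b_def)
  have sd: "\<langle>s, \<delta>\<rangle> = b * c"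
    using curvature_spd_pos spd_sym[OF G, of u \<delta>]
    by (simp add: s blinfun.bilinear_simps a_def c_def[symmetric])
  have gs: "\<langle>\<gamma>, H s\<rangle> = b * c - a * c + b * \<langle>\<gamma>, H \<gamma>\<rangle>"
    by (simp add: Hs blinfun.bilinear_simps bc c_def[symmetric])
  have "bfgs_update H \<delta> \<gamma> s = u - a *\<^sub>R \<delta> + b *\<^sub>R H \<gamma> - b *\<^sub>R H \<gamma>
      + (- (1 / c) * (b * c - a * c + b * \<langle>\<gamma>, H \<gamma>\<rangle>) + (\<langle>\<gamma>, H \<gamma>\<rangle> / c + 1) / c * (b * c)) *\<^sub>R \<delta>"
    using c unfolding bfgs_update_def sd gs c_def[symmetric] unfolding Hs by (simp add: algebra_simps)
  \<comment> \<open>All terms in \<open>\<langle>\<gamma>, H \<gamma>\<rangle>\<close> cancel, and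
    the remaining \<open>a\<close> compensates the deflation term
    \<open>- a *\<^sub>R \<delta>\<close>.\<close>
  also have "- (1 / c) * (b * c - a * c + b * \<langle>\<gamma>, H \<gamma>\<rangle>) + (\<langle>\<gamma>, H \<gamma>\<rangle> / c + 1) / c * (b * c) = a"
    using c by (simp add: field_simps)
  finally show ?thesis by (simp add: s_def)
qed

text \<open>Only one composition is computed. The updated inverse operator is bijective, being
  positive definite, so its left inverse is two-sided.\<close>

lemma bfgs_inv_update_inverse:
  assumes bij: "bij H" and HG: "inv H = G"
  shows "bij (bfgs_update H \<delta> \<gamma>)" and "inv (bfgs_update H \<delta> \<gamma>) = bfgs_inv_update G \<delta> \<gamma>"
proof -
  let ?G = "bfgs_inv_update G \<delta> \<gamma>" and ?H = "bfgs_update H \<delta> \<gamma>"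
  have "H = inv G" using inv_inv_eq[OF bij] HG by simp
  then have H: "linear H" "\<And>u. H (G u) = u"
    using spd_inv_linear[OF G] spd_inv_left[OF G] by simp_all
  note left = bfgs_update_inv_update[OF H]
  have right: "?G (?H s) = s" for s
    using left spd_inv_right[OF bfgs_inv_update_spd, of s] by metis
  show "bij ?H" by (rule o_bij[of ?G]) (auto simp: left right)
  show "inv ?H = ?G" by (rule inv_equality) (rule right left)+
qed

text \<open>The quotient of the new operator by the old one is a product of two rank-one perturbations of
  the identity.  The perturbation by \<open>\<gamma>\<close> is taken first because it is invertible, whereas the one by
  \<open>G \<delta>\<close> on its own annihilates \<open>\<delta>\<close>.\<close>

lemma op_det_bfgs_inv_update:
  assumes X: "self_adjoint_pos_def X"
  shows "op_det (\<lambda>u. inv X (bfgs_inv_update G \<delta> \<gamma> u))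
    = \<langle>\<gamma>, \<delta>\<rangle> / \<langle>G \<delta>, \<delta>\<rangle> * op_det (\<lambda>u. inv X (G u))"
proof -
  define c g w where "c = \<langle>\<gamma>, \<delta>\<rangle>" and "g = \<langle>G \<delta>, \<delta>\<rangle>" and "w = inv G \<gamma>"
  have c: "c > 0" and g: "g > 0" using curv curvature_spd_pos by (simp_all add: c_def g_def)
  have gw: "\<langle>\<gamma>, w\<rangle> \<ge> 0" unfolding w_def by (rule spd_inv_nonneg[OF G])
  have Gw: "G w = \<gamma>" by (simp add: w_def spd_inv_right[OF G])
  \<comment> \<open>This \<open>t\<close> solves \<open>S1 e = \<delta>\<close> for
    \<open>e = \<delta> - t *\<^sub>R w\<close>. Hence \<open>S1\<close> maps the correction along
    \<open>e\<close> in \<open>S2\<close> to the required correction along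
    \<open>\<delta>\<close>.\<close>
  define t where "t = c / (c + \<langle>\<gamma>, w\<rangle>)"
  have t: "t * (c + \<langle>\<gamma>, w\<rangle>) = c" "t > 0" using c gw by (simp_all add: t_def)
  define e where "e = \<delta> - t *\<^sub>R w"
  define S1 where "S1 u = u + \<langle>(1 / c) *\<^sub>R \<gamma>, u\<rangle> *\<^sub>R w" for u
  define S2 where "S2 u = u + \<langle>(1 / g) *\<^sub>R G \<delta>, u\<rangle> *\<^sub>R (- e)" for u
  have S1_lin: "linear S1"
    by (rule linearI) (simp_all add: S1_def blinfun.bilinear_simps algebra_simps add_divide_distrib)
  have "\<langle>\<gamma>, e\<rangle> = c - t * \<langle>\<gamma>, w\<rangle>"
    by (simp add: e_def blinfun.bilinear_simps c_def)
  then have "S1 e = \<delta> + ((c - t * \<langle>\<gamma>, w\<rangle>) / c - t) *\<^sub>R w"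
    by (simp add: S1_def blinfun.scaleR_left scaleR_diff_left) (simp add: e_def)
  also have "(c - t * \<langle>\<gamma>, w\<rangle>) / c - t = 0" using c t(1) by (simp add: field_simps)
  finally have S1e: "S1 e = \<delta>" by simp
  interpret S1: linear S1 by (rule S1_lin)
  have "S2 u = u - (\<langle>G \<delta>, u\<rangle> / g) *\<^sub>R e" for u
    by (simp add: S2_def blinfun.bilinear_simps)
  then have "S1 (S2 u) = u + (\<langle>\<gamma>, u\<rangle> / c) *\<^sub>R w - (\<langle>G \<delta>, u\<rangle> / g) *\<^sub>R \<delta>" for u
    by (simp add: S1.diff S1.scale S1e) (simp add: S1_def blinfun.bilinear_simps)
  then have upd: "bfgs_inv_update G \<delta> \<gamma> u = G (S1 (S2 u))" for u
    by (simp add: bfgs_inv_update_def G.add G.diff G.scale Gw c_def g_def)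
  have "linear (\<lambda>u. inv X (G u))"
    using linear_compose[OF spd_linear[OF G] spd_inv_linear[OF X]] by (simp add: o_def)
  then have "op_det (\<lambda>u. inv X (bfgs_inv_update G \<delta> \<gamma> u))
      = op_det (\<lambda>u. inv X (G u)) * (op_det S1 * op_det S2)"
    using op_det_compose[of "\<lambda>u. inv X (G u)" "\<lambda>u. S1 (S2 u)"] op_det_compose[OF S1_lin, of S2]
    by (simp add: upd)
  also have "op_det S1 = 1 + \<langle>\<gamma>, w\<rangle> / c"
    unfolding S1_def op_det_rank_one by (simp add: blinfun.bilinear_simps)
  also have "op_det S2 = t * c / g"
  proof -
    have "\<langle>G \<delta>, w\<rangle> = c" using spd_sym[OF G, of \<delta> w] by (simp add: Gw c_def)
    then show ?thesis
      unfolding S2_def op_det_rank_one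
      using g by (simp add: blinfun.bilinear_simps e_def g_def[symmetric] field_simps)
  qed
  also have "(1 + \<langle>\<gamma>, w\<rangle> / c) * (t * c / g) = c / g"
    using c g t(1) by (simp add: field_simps)
  finally show ?thesis by (simp add: c_def g_def)
qed

lemma op_trace_bfgs_inv_update:
  assumes X: "self_adjoint_pos_def X"
  shows "op_trace (\<lambda>u. inv X (bfgs_inv_update G \<delta> \<gamma> u - X u)) =
    op_trace (\<lambda>u. inv X (G u - X u))
      - \<langle>G \<delta>, inv X (G \<delta>)\<rangle> / \<langle>G \<delta>, \<delta>\<rangle> + \<langle>\<gamma>, inv X \<gamma>\<rangle> / \<langle>\<gamma>, \<delta>\<rangle>"
proof -
  interpret I: linear "inv X" by (rule spd_inv_linear[OF X])
  have "inv X (bfgs_inv_update G \<delta> \<gamma> u - X u) = inv X (G u - X u) +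
      (\<langle>G \<delta>, u\<rangle> *\<^sub>R ((- 1 / \<langle>G \<delta>, \<delta>\<rangle>) *\<^sub>R inv X (G \<delta>))
        + \<langle>\<gamma>, u\<rangle> *\<^sub>R ((1 / \<langle>\<gamma>, \<delta>\<rangle>) *\<^sub>R inv X \<gamma>))" for u
    by (simp add: bfgs_inv_update_def I.add I.diff I.scale)
  then show ?thesis
    by (simp only: op_trace_add op_trace_rank_one) (simp add: blinfun.bilinear_simps)
qed

text \<open>The drop equals \<open>a / g - \<langle>\<gamma>, inv X \<gamma>\<rangle> / c + ln (c /
  g)\<close>. Bounding \<open>a / g\<close> below by \<open>1 + ln (a / g)\<close> merges the
  logarithms.\<close>

lemma psi_bfgs_inv_update:
  assumes X: "self_adjoint_pos_def X" and det: "op_det (\<lambda>u. inv X (G u)) > 0"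
  shows "psi X G - psi X (bfgs_inv_update G \<delta> \<gamma>) \<ge>
    ln (\<langle>\<gamma>, \<delta>\<rangle> * \<langle>G \<delta>, inv X (G \<delta>)\<rangle> / \<langle>G \<delta>, \<delta>\<rangle>\<^sup>2) + 1 - \<langle>\<gamma>, inv X \<gamma>\<rangle> / \<langle>\<gamma>, \<delta>\<rangle>"
proof -
  define a g c where "a = \<langle>G \<delta>, inv X (G \<delta>)\<rangle>" and "g = \<langle>G \<delta>, \<delta>\<rangle>" and "c = \<langle>\<gamma>, \<delta>\<rangle>"
  have c: "c > 0" and g: "g > 0" using curv curvature_spd_pos by (simp_all add: c_def g_def)
  have "G \<delta> \<noteq> 0" using g by (auto simp: g_def)
  then have a: "a > 0" unfolding a_def by (rule spd_inv_pos[OF X])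
  have "ln (op_det (\<lambda>u. inv X (bfgs_inv_update G \<delta> \<gamma> u)))
      = ln (c / g) + ln (op_det (\<lambda>u. inv X (G u)))"
    unfolding op_det_bfgs_inv_update[OF X] c_def[symmetric] g_def[symmetric]
    by (rule ln_mult_pos) (use det c g in simp_all)
  then have "psi X G - psi X (bfgs_inv_update G \<delta> \<gamma>) = a / g - \<langle>\<gamma>, inv X \<gamma>\<rangle> / c + ln (c / g)"
    unfolding psi_def op_trace_bfgs_inv_update[OF X] by (simp add: a_def c_def g_def)
  moreover have "ln (a / g) \<le> a / g - 1" using a g by (intro ln_le_minus_one) simp
  moreover have "ln (c * a / g\<^sup>2) = ln (a / g) + ln (c / g)"
    using a c g by (subst ln_mult_pos[symmetric]) (simp_all add: power2_eq_square mult.commute)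
  ultimately show ?thesis by (simp add: a_def c_def g_def)
qed

end

text \<open>Updating \<open>Y\<close> with \<open>\<gamma> = X e\<close>, where \<open>e\<close> is \<open>X\<close>-orthogonal to the subspace on which \<open>Y\<close> and
  \<open>X\<close> already agree, enlarges that subspace and does not increase \<open>psi X Y\<close>.  After finitely many
  updates \<open>Y\<close> has become \<open>X\<close>.\<close>

lemma psi_nonneg_and_op_det_pos:
  assumes X: "self_adjoint_pos_def X" and Y: "self_adjoint_pos_def (Y :: 'a::euclidean_space \<Rightarrow> _)"
  shows "psi X Y \<ge> 0 \<and> op_det (\<lambda>u. inv X (Y u)) > 0"
  using Y
proof (induction "DIM('a) - dim {u. Y u = X u}" arbitrary: Y rule: less_induct)
  case less
  note Y = \<open>self_adjoint_pos_def Y\<close>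
  interpret X: linear X by (rule spd_linear[OF X])
  interpret Y: linear Y by (rule spd_linear[OF Y])
  define S where "S = {u. Y u = X u}"
  show ?case
  proof (cases "dim S < DIM('a)")
    case False
    have sub: "subspace S"
      by (auto simp: S_def subspace_def X.zero Y.zero X.add Y.add X.scale Y.scale)
    have "S = UNIV"
      using False dim_subset_UNIV[of S] dim_eq_full[of S] sub by (simp add: span_eq_iff[THEN iffD2])
    then have "Y = X" by (auto simp: S_def)
    then show ?thesis
      by (simp add: psi_def spd_inv_left[OF X] op_det_ident op_trace_zero linear_0[OF spd_inv_linear[OF X]])
  next
    case True
    then obtain v where v: "v \<noteq> 0" "\<And>u. u \<in> span S \<Longrightarrow> orthogonal v u"
      using orthogonal_to_subspace_exists by metis
    \<comment> \<open>\<open>inv X\<close> turns orthogonality of \<open>v\<close> to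
      \<open>S\<close> into \<open>X\<close>-orthogonality of \<open>e\<close>.\<close>
    define e where "e = inv X (blinfun_inner_left v)"
    have Xe: "X e = blinfun_inner_left v" by (simp add: e_def spd_inv_right[OF X])
    have orth: "\<langle>X e, u\<rangle> = 0" if "u \<in> S" for u
      using v(2)[OF span_base[OF that]] by (simp add: Xe orthogonal_def inner_commute)
    have "\<langle>X e, v\<rangle> \<noteq> 0" using v(1) by (simp add: Xe)
    then have "e \<noteq> 0" using X.zero by auto
    then have pos: "\<langle>X e, e\<rangle> > 0" "\<langle>Y e, e\<rangle> > 0" using spd_pos[OF X] spd_pos[OF Y] by auto
    define Y' where "Y' = bfgs_inv_update Y e (X e)"
    have Y': "self_adjoint_pos_def Y'"
      unfolding Y'_def by (rule bfgs_inv_update_spd[OF Y pos(1)])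
    have "Y' u = X u" if "u \<in> S" for u
    proof -
      have "Y u = X u" using that by (simp add: S_def)
      moreover have "\<langle>Y e, u\<rangle> = \<langle>X e, u\<rangle>"
        using \<open>Y u = X u\<close> spd_sym[OF X, of e u] spd_sym[OF Y, of e u] by simp
      ultimately show ?thesis using orth[OF that] by (simp add: Y'_def bfgs_inv_update_def)
    qed
    moreover have "Y' e = X e" using pos by (simp add: Y'_def bfgs_inv_update_def)
    ultimately have sub: "insert e S \<subseteq> {u. Y' u = X u}" by auto
    have "e \<notin> span S"
      using v(2)[of e] pos(1) by (auto simp: Xe orthogonal_def inner_commute)
    then have "dim (insert e S) = dim S + 1" by (simp add: dim_insert)
    then have "dim S < dim {u. Y' u = X u}" using dim_subset[OF sub] by simp
    then have "DIM('a) - dim {u. Y' u = X u} < DIM('a) - dim S" using True by simp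
    then have IH: "psi X Y' \<ge> 0" "op_det (\<lambda>u. inv X (Y' u)) > 0"
      using less.hyps[of Y'] Y' by (auto simp: S_def)
    \<comment> \<open>The update multiplies the determinant by the positive number
      \<open>\<langle>X e, e\<rangle> / \<langle>Y e, e\<rangle>\<close>, so positivity passes back
      from \<open>Y'\<close> to \<open>Y\<close>.\<close>
    have det: "op_det (\<lambda>u. inv X (Y u)) > 0"
      using IH(2) pos op_det_bfgs_inv_update[OF Y pos(1) X]
      by (simp add: Y'_def zero_less_mult_iff zero_less_divide_iff)
    \<comment> \<open>Cauchy-Schwarz makes the logarithm in the drop nonnegative; for
      \<open>\<gamma> = X e\<close> the other terms of the bound cancel.\<close>
    have "1 \<le> \<langle>X e, e\<rangle> * \<langle>Y e, inv X (Y e)\<rangle> / \<langle>Y e, e\<rangle>\<^sup>2"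
      using spd_dual_Cauchy_Schwarz[OF X, of "Y e" e] pos by (simp add: mult.commute)
    then have "ln (\<langle>X e, e\<rangle> * \<langle>Y e, inv X (Y e)\<rangle> / \<langle>Y e, e\<rangle>\<^sup>2) \<ge> 0" by simp
    moreover have "\<langle>X e, inv X (X e)\<rangle> / \<langle>X e, e\<rangle> = 1"
      using pos by (simp add: spd_inv_left[OF X])
    ultimately have "psi X Y \<ge> psi X Y'"
      using psi_bfgs_inv_update[OF Y pos(1) X det] by (simp add: Y'_def)
    then show ?thesis using IH det by simp
  qed
qed

lemmas psi_nonneg = psi_nonneg_and_op_det_pos[THEN conjunct1]
  and op_det_inv_spd_pos = psi_nonneg_and_op_det_pos[THEN conjunct2]

subsection \<open>Strongly convex functions with Lipschitz gradient\<close>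

lemma normB_square:
  assumes "self_adjoint_pos_def B"
  shows "(normB B u)\<^sup>2 = \<langle>B u, u\<rangle>"
  using spd_nonneg[OF assms] by (simp add: normB_def)

lemma dual_normB_square:
  assumes "self_adjoint_pos_def B"
  shows "(dual_normB B s)\<^sup>2 = \<langle>s, inv B s\<rangle>"
  using spd_inv_nonneg[OF assms] by (simp add: dual_normB_def)

lemma has_derivative_grad:
  assumes "f differentiable (at y)"
  shows "(f has_derivative blinfun_apply (grad f y)) (at y)"
  using assms
  by (metis grad_def frechet_derivative_works bounded_linear_Blinfun_apply has_derivative_bounded_linear)

lemma has_real_derivative_along_line:
  assumes "\<And>y. f differentiable (at y)"
  shows "((\<lambda>t. f (y + t *\<^sub>R w)) has_real_derivative \<langle>grad f (y + t *\<^sub>R w), w\<rangle>) (at t)"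
proof -
  have "((\<lambda>t. y + t *\<^sub>R w) has_derivative (\<lambda>h. h *\<^sub>R w)) (at t)"
    by (auto intro!: derivative_eq_intros)
  from has_derivative_compose[OF this has_derivative_grad[OF assms]]
  show ?thesis
    by (simp add: has_field_derivative_def blinfun.scaleR_right mult.commute[of _ "\<langle>_, w\<rangle>"])
qed

context
  fixes f :: "'a::euclidean_space \<Rightarrow> real" and B :: "'a \<Rightarrow> 'a dual" and \<mu> L :: real
  assumes B: "self_adjoint_pos_def B"
    and f_diff: "\<And>y. f differentiable (at y)"
    and mu_pos: "\<mu> > 0"
    and L_pos: "L > 0"
    and strong: "\<And>y z. \<langle>grad f y - grad f z, y - z\<rangle> \<ge> \<mu> * (normB B (y - z))\<^sup>2"
    and lipschitz: "\<And>y z. dual_normB B (grad f y - grad f z) \<le> L * normB B (y - z)"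
begin

interpretation B: linear B by (rule spd_linear[OF B])

lemma strong_monotone: "\<langle>grad f (y + w) - grad f y, w\<rangle> \<ge> \<mu> * \<langle>B w, w\<rangle>"
  using strong[of "y + w" y] by (simp add: normB_square[OF B])

lemma lipschitz_square:
  "\<langle>grad f (y + w) - grad f y, inv B (grad f (y + w) - grad f y)\<rangle> \<le> L\<^sup>2 * \<langle>B w, w\<rangle>"
proof -
  have "(dual_normB B (grad f (y + w) - grad f y))\<^sup>2 \<le> (L * normB B w)\<^sup>2"
    using lipschitz[of "y + w" y] spd_inv_nonneg[OF B]
    by (intro power_mono) (simp_all add: dual_normB_def)
  then show ?thesis
    by (simp add: dual_normB_square[OF B] normB_square[OF B] power_mult_distrib)
qed

lemma gradient_increment_upper: "\<langle>grad f (y + w) - grad f y, w\<rangle> \<le> L * \<langle>B w, w\<rangle>"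
proof (rule power2_le_imp_le)
  have "\<langle>grad f (y + w) - grad f y, w\<rangle>\<^sup>2
      \<le> \<langle>grad f (y + w) - grad f y, inv B (grad f (y + w) - grad f y)\<rangle> * \<langle>B w, w\<rangle>"
    by (rule spd_dual_Cauchy_Schwarz[OF B])
  also have "\<dots> \<le> L\<^sup>2 * \<langle>B w, w\<rangle> * \<langle>B w, w\<rangle>"
    by (intro mult_right_mono lipschitz_square spd_nonneg[OF B])
  finally show "\<langle>grad f (y + w) - grad f y, w\<rangle>\<^sup>2 \<le> (L * \<langle>B w, w\<rangle>)\<^sup>2"
    by (simp add: power2_eq_square mult_ac)
  show "0 \<le> L * \<langle>B w, w\<rangle>" using L_pos spd_nonneg[OF B] by simp
qed

text \<open>Along the segment, \<open>\<phi>\<close> is the gap between the two sides with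
  \<open>t *\<^sub>R w\<close> for \<open>w\<close>. Strong monotonicity makes its derivative
  nonnegative.\<close>

lemma quadratic_lower_bound: "f (y + w) \<ge> f y + \<langle>grad f y, w\<rangle> + \<mu> / 2 * \<langle>B w, w\<rangle>"
proof -
  define \<phi> where "\<phi> t = f (y + t *\<^sub>R w) - t * \<langle>grad f y, w\<rangle> - \<mu> / 2 * t\<^sup>2 * \<langle>B w, w\<rangle>" for t
  have "\<phi> 0 \<le> \<phi> 1"
  proof (rule DERIV_nonneg_imp_nondecreasing[where f = \<phi>])
    fix t :: real assume "0 \<le> t"
    let ?D = "\<langle>grad f (y + t *\<^sub>R w) - grad f y, w\<rangle> - \<mu> * t * \<langle>B w, w\<rangle>"
    have "DERIV \<phi> t :> ?D"
      unfolding \<phi>_def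
      by (rule derivative_eq_intros has_real_derivative_along_line f_diff refl)+
        (simp add: blinfun.diff_left)
    moreover have "?D \<ge> 0"
    \<comment> \<open>Monotonicity for the increment \<open>t *\<^sub>R w\<close> yields the claim
      multiplied by \<open>t\<close>, so division requires \<open>t\<close> to be nonzero.\<close>
    proof (cases "t = 0")
      case False
      have "t * (\<mu> * t * \<langle>B w, w\<rangle>) \<le> t * \<langle>grad f (y + t *\<^sub>R w) - grad f y, w\<rangle>"
        using strong_monotone[of "t *\<^sub>R w" y]
        by (simp add: B.scale blinfun.scaleR_left blinfun.scaleR_right mult_ac)
      then show ?thesis using False \<open>0 \<le> t\<close> by simp
    qed simp
    ultimately show "\<exists>D. DERIV \<phi> t :> D \<and> D \<ge> 0" by blast
  qed simp
  then show ?thesis by (simp add: \<phi>_def)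
qed

lemma quadratic_upper_bound: "f (y + w) \<le> f y + \<langle>grad f y, w\<rangle> + L / 2 * \<langle>B w, w\<rangle>"
proof -
  define \<phi> where "\<phi> t = t * \<langle>grad f y, w\<rangle> + L / 2 * t\<^sup>2 * \<langle>B w, w\<rangle> - f (y + t *\<^sub>R w)" for t
  have "\<phi> 0 \<le> \<phi> 1"
  proof (rule DERIV_nonneg_imp_nondecreasing[where f = \<phi>])
    fix t :: real assume "0 \<le> t"
    let ?D = "L * t * \<langle>B w, w\<rangle> - \<langle>grad f (y + t *\<^sub>R w) - grad f y, w\<rangle>"
    have "DERIV \<phi> t :> ?D"
      unfolding \<phi>_def
      by (rule derivative_eq_intros has_real_derivative_along_line f_diff refl)+
        (simp add: blinfun.diff_left)
    moreover have "?D \<ge> 0"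
    proof (cases "t = 0")
      case False
      have "t * \<langle>grad f (y + t *\<^sub>R w) - grad f y, w\<rangle> \<le> t * (L * t * \<langle>B w, w\<rangle>)"
        using gradient_increment_upper[of y "t *\<^sub>R w"]
        by (simp add: B.scale blinfun.scaleR_left blinfun.scaleR_right mult_ac)
      then show ?thesis using False \<open>0 \<le> t\<close> by simp
    qed simp
    ultimately show "\<exists>D. DERIV \<phi> t :> D \<and> D \<ge> 0" by blast
  qed simp
  then show ?thesis by (simp add: \<phi>_def)
qed

text \<open>The direction \<open>s\<close> stays free because cocoercivity needs it to be a
  difference of gradients.\<close>

lemma gradient_step_decrease:
  "f (y - (1 / L) *\<^sub>R inv B s) \<le> f y - \<langle>grad f y, inv B s\<rangle> / L + \<langle>s, inv B s\<rangle> / (2 * L)"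
  using quadratic_upper_bound[of y "- (1 / L) *\<^sub>R inv B s"] L_pos
  by (simp add: B.scale B.neg blinfun.bilinear_simps spd_inv_right[OF B] field_simps)

text \<open>The function \<open>f\<close> minus its linear part at \<open>y\<close> is minimal at
  \<open>y\<close>, so a gradient step on it from \<open>z\<close> cannot go below that value. This
  gives \<open>half\<close>; adding its copy with \<open>y\<close> and \<open>z\<close> exchanged
  cancels the function values.\<close>

lemma gradient_cocoercive:
  "\<langle>grad f z - grad f y, inv B (grad f z - grad f y)\<rangle> \<le> L * \<langle>grad f z - grad f y, z - y\<rangle>"
proof -
  have half: "\<langle>grad f z - grad f y, inv B (grad f z - grad f y)\<rangle> / (2 * L)
      \<le> f z - f y - \<langle>grad f y, z - y\<rangle>" for y z
  proof -
    define s where "s = grad f z - grad f y"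
    define v where "v = z - (1 / L) *\<^sub>R inv B s"
    have "f y + \<langle>grad f y, v - y\<rangle> \<le> f v"
      using quadratic_lower_bound[of y "v - y"] mu_pos spd_nonneg[OF B, of "v - y"]
      by (smt (verit) add_diff_cancel_left' diff_add_cancel add.commute mult_nonneg_nonneg divide_nonneg_pos)
    moreover have "f v \<le> f z - \<langle>grad f z, inv B s\<rangle> / L + \<langle>s, inv B s\<rangle> / (2 * L)"
      unfolding v_def by (rule gradient_step_decrease)
    moreover have "\<langle>grad f y, v - y\<rangle> = \<langle>grad f y, z - y\<rangle> - \<langle>grad f y, inv B s\<rangle> / L"
      by (simp add: v_def blinfun.bilinear_simps)
    moreover have "\<langle>s, inv B s\<rangle> / L = \<langle>grad f z, inv B s\<rangle> / L - \<langle>grad f y, inv B s\<rangle> / L"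
      by (simp add: s_def blinfun.diff_left diff_divide_distrib)
    moreover have "\<langle>s, inv B s\<rangle> / (2 * L) = \<langle>s, inv B s\<rangle> / L - \<langle>s, inv B s\<rangle> / (2 * L)"
      by simp
    ultimately show ?thesis unfolding s_def[symmetric] by linarith
  qed
  define q where "q = \<langle>grad f z - grad f y, inv B (grad f z - grad f y)\<rangle>"
  have "\<langle>grad f y - grad f z, inv B (grad f y - grad f z)\<rangle> = q"
    using linear_neg[OF spd_inv_linear[OF B], of "grad f z - grad f y"]
    by (simp add: q_def blinfun.bilinear_simps)
  then have "q / (2 * L) + q / (2 * L) \<le> \<langle>grad f z, z - y\<rangle> - \<langle>grad f y, z - y\<rangle>"
    using half[of z y] half[of y z]
    by (simp add: q_def[symmetric] blinfun.diff_right)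
  moreover have "q / (2 * L) + q / (2 * L) = q / L" by simp
  ultimately have "q / L \<le> \<langle>grad f z - grad f y, z - y\<rangle>" by (simp add: blinfun.diff_left)
  then show ?thesis using L_pos by (simp add: q_def field_simps)
qed

lemma gradient_dominance: "f y - f z \<le> \<langle>grad f y, inv B (grad f y)\<rangle> / (2 * \<mu>)"
proof -
  define g w where "g = grad f y" and "w = z - y"
  \<comment> \<open>\<open>?v\<close> vanishes at the \<open>w\<close> minimizing the quadratic
    lower bound, so its nonnegative form completes the square.\<close>
  let ?v = "w + (1 / \<mu>) *\<^sub>R inv B g"
  have "\<langle>B w, inv B g\<rangle> = \<langle>g, w\<rangle>"
    using spd_sym[OF B, of w "inv B g"] by (simp add: spd_inv_right[OF B])
  then have "\<langle>B ?v, ?v\<rangle> = \<langle>B w, w\<rangle> + 2 * \<langle>g, w\<rangle> / \<mu> + \<langle>g, inv B g\<rangle> / \<mu>\<^sup>2"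
    by (simp add: B.add B.scale spd_inv_right[OF B] blinfun.bilinear_simps power2_eq_square
        add_divide_distrib)
  then have "\<langle>B w, w\<rangle> + 2 * \<langle>g, w\<rangle> / \<mu> + \<langle>g, inv B g\<rangle> / \<mu>\<^sup>2 \<ge> 0"
    using spd_nonneg[OF B, of ?v] by simp
  then have "\<mu> / 2 * (\<langle>B w, w\<rangle> + 2 * \<langle>g, w\<rangle> / \<mu> + \<langle>g, inv B g\<rangle> / \<mu>\<^sup>2) \<ge> 0"
    using mu_pos by (intro mult_nonneg_nonneg) auto
  also have "\<mu> / 2 * (\<langle>B w, w\<rangle> + 2 * \<langle>g, w\<rangle> / \<mu> + \<langle>g, inv B g\<rangle> / \<mu>\<^sup>2)
      = \<mu> / 2 * \<langle>B w, w\<rangle> + \<langle>g, w\<rangle> + \<langle>g, inv B g\<rangle> / (2 * \<mu>)"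
    using mu_pos by (simp add: field_simps power2_eq_square)
  finally show ?thesis
    using quadratic_lower_bound[of y w] by (simp add: w_def g_def)
qed

lemma minimizer_exists: "\<exists>m. \<forall>y. f m \<le> f y"
proof -
  obtain c where c: "c > 0" "\<And>u. \<langle>B u, u\<rangle> \<ge> c * (norm u)\<^sup>2"
    using spd_norm_lower[OF B] by blast
  \<comment> \<open>Beyond radius \<open>R\<close> the quadratic term of the lower bound at
    \<open>0\<close> outweighs the linear one.\<close>
  define g R where "g = grad f 0" and "R = 2 * norm g / (\<mu> * c)"
  have R: "R \<ge> 0" using c mu_pos by (simp add: R_def)
  have outside: "f 0 \<le> f y" if "norm y > R" for y
  proof -
    have "norm g * norm y \<le> \<mu> / 2 * (c * (norm y)\<^sup>2)"
    proof -
      have "norm g \<le> \<mu> / 2 * c * norm y"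
        using that c mu_pos by (simp add: R_def field_simps)
      then have "norm g * norm y \<le> \<mu> / 2 * c * norm y * norm y"
        by (intro mult_right_mono) auto
      then show ?thesis by (simp add: power2_eq_square mult_ac)
    qed
    also have "\<dots> \<le> \<mu> / 2 * \<langle>B y, y\<rangle>"
      using c(2)[of y] mu_pos by (intro mult_left_mono) auto
    finally have "norm g * norm y \<le> \<mu> / 2 * \<langle>B y, y\<rangle>" .
    moreover have "\<bar>\<langle>g, y\<rangle>\<bar> \<le> norm g * norm y"
      using norm_blinfun[of g y] by simp
    ultimately show ?thesis using quadratic_lower_bound[of 0 y] by (simp add: g_def)
  qed
  have "continuous_on (cball 0 R) f"
    by (intro differentiable_imp_continuous_on)
      (auto simp: differentiable_on_def intro: differentiable_at_withinI f_diff)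
  moreover have "cball (0::'a) R \<noteq> {}" using R by simp
  ultimately obtain m where m: "\<And>y. y \<in> cball 0 R \<Longrightarrow> f m \<le> f y"
    using continuous_attains_inf[OF compact_cball] by blast
  have "f m \<le> f y" for y
  proof (cases "norm y \<le> R")
    case False
    have "f m \<le> f 0" using R by (intro m) simp
    also have "f 0 \<le> f y" using False by (intro outside) simp
    finally show ?thesis .
  qed (simp add: m)
  then show ?thesis by blast
qed

text \<open>\<open>LEAST\<close> over a set of reals is informative only when the minimum is
  attained, which strong convexity guarantees here.\<close>

lemma Least_range_lower: "(LEAST v. v \<in> range f) \<le> f y"
  and Least_range_attained: "\<exists>m. f m = (LEAST v. v \<in> range f)"
proof -
  obtain m where m: "\<And>y. f m \<le> f y" using minimizer_exists by blast
  have "(LEAST v. v \<in> range f) = f m"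
    by (rule Least_equality) (auto simp: m)
  then show "(LEAST v. v \<in> range f) \<le> f y" "\<exists>m. f m = (LEAST v. v \<in> range f)"
    using m by auto
qed

text \<open>A gradient step of length \<open>1 / L\<close> strictly decreases \<open>f\<close>. This
  keeps the gaps positive, so their successive ratios are defined.\<close>

lemma not_minimal_if_grad_nonzero:
  assumes "grad f y \<noteq> 0"
  shows "(LEAST v. v \<in> range f) < f y"
proof -
  let ?q = "\<langle>grad f y, inv B (grad f y)\<rangle>"
  have "?q / (2 * L) > 0" using spd_inv_pos[OF B assms] L_pos by simp
  moreover have "?q / L = ?q / (2 * L) + ?q / (2 * L)" by simp
  ultimately have "f (y - (1 / L) *\<^sub>R inv B (grad f y)) < f y"
    using gradient_step_decrease[of y "grad f y"] by linarith
  then show ?thesis using Least_range_lower by (rule le_less_trans[rotated])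
qed

end

subsection \<open>The convergence rate\<close>

text \<open>The purely numerical part, applied with \<open>\<epsilon>\<close> the gap in function
  value, \<open>q\<close> the squared cosines and \<open>r\<close> the inverse condition
  number.\<close>

lemma geometric_rate_of_log_sum:
  fixes \<epsilon> q :: "nat \<Rightarrow> real"
  assumes eps: "\<And>i. \<epsilon> i > 0" and q: "\<And>i. q i > 0" and r: "r > 0" and c: "c > 0"
    and dec: "\<And>i. \<epsilon> (Suc i) \<le> (1 - c * q i) * \<epsilon> i"
    and log_sum: "(\<Sum>i<k. ln (r / q i)) \<le> \<Psi>" and k: "k \<ge> 1"
  shows "\<epsilon> k \<le> (1 - c * (r * exp (- \<Psi> / real k))) ^ k * \<epsilon> 0"
proof -
  define p where "p = r * exp (- \<Psi> / real k)"
  have p: "p > 0" using r by (simp add: p_def)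
  have "ln p = ln r - \<Psi> / real k" using r by (simp add: p_def ln_mult_pos)
  then have "real k * ln p = real k * ln r - \<Psi>" using k by (simp add: right_diff_distrib)
  \<comment> \<open>\<open>p\<close> is the lower bound on the geometric mean of the
    \<open>q i\<close>; the logarithmic hypothesis says precisely this.\<close>
  then have "0 \<le> (\<Sum>i<k. ln (q i / p))"
    using log_sum q r p by (simp add: ln_divide_pos sum_subtractf)
  also have "\<dots> \<le> (\<Sum>i<k. q i / p - 1)"
    by (intro sum_mono ln_le_minus_one divide_pos_pos q p)
  also have "\<dots> = (\<Sum>i<k. q i) / p - k"
    by (simp add: sum_subtractf sum_divide_distrib)
  finally have sum_q: "real k * p \<le> (\<Sum>i<k. q i)" using p by (simp add: field_simps)

  define a m where "a i = \<epsilon> (Suc i) / \<epsilon> i" and "m = 1 - c * p" for i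
  have a_pos: "a i > 0" for i using eps by (simp add: a_def)
  have a_le: "a i \<le> 1 - c * q i" for i using dec[of i] eps[of i] by (simp add: a_def field_simps)
  have "(\<Sum>i<k. a i) \<le> (\<Sum>i<k. 1 - c * q i)" by (intro sum_mono a_le)
  also have "\<dots> = real k - c * (\<Sum>i<k. q i)" by (simp add: sum_subtractf sum_distrib_left)
  also have "\<dots> \<le> real k - c * (real k * p)"
    using sum_q c by (intro diff_left_mono mult_left_mono) auto
  finally have sum_a: "(\<Sum>i<k. a i) \<le> real k * m" by (simp add: m_def algebra_simps)
  \<comment> \<open>Positivity of the final base \<open>m\<close> is derived from the ratios, which
    are positive with mean at most \<open>m\<close>.\<close>
  have "(\<Sum>i<k. a i) > 0" using k a_pos by (intro sum_pos) (auto simp: lessThan_empty_iff)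
  then have "real k * m > 0" using sum_a by linarith
  then have m: "m > 0" by (simp add: zero_less_mult_iff)

  \<comment> \<open>AM-GM in exponential form; the total exponent is nonpositive by
    \<open>sum_a\<close>.\<close>
  have "(\<Prod>i<k. a i) \<le> (\<Prod>i<k. m * exp (a i / m - 1))"
  proof (intro prod_mono conjI)
    fix i
    show "0 \<le> a i" using a_pos[of i] by simp
    have "a i / m \<le> exp (a i / m - 1)" using exp_ge_add_one_self[of "a i / m - 1"] by simp
    then show "a i \<le> m * exp (a i / m - 1)" using m by (simp add: field_simps)
  qed
  also have "\<dots> = m ^ k * exp ((\<Sum>i<k. a i) / m - k)"
    by (simp add: prod.distrib exp_sum[symmetric] sum_subtractf sum_divide_distrib)
  also have "\<dots> \<le> m ^ k * exp 0"
    using sum_a m by (intro mult_left_mono) (simp_all add: field_simps)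
  finally have prod_a: "(\<Prod>i<k. a i) \<le> m ^ k" by simp
  have "\<epsilon> n = (\<Prod>i<n. a i) * \<epsilon> 0" for n
  proof (induction n)
    case (Suc n)
    have "\<epsilon> (Suc n) = a n * \<epsilon> n" using eps[of n] by (simp add: a_def)
    with Suc show ?case by simp
  qed simp
  then have "\<epsilon> k = (\<Prod>i<k. a i) * \<epsilon> 0" .
  also have "\<dots> \<le> m ^ k * \<epsilon> 0"
    using prod_a eps[of 0] by (intro mult_right_mono) auto
  finally show ?thesis by (simp add: m_def p_def)
qed

theorem theorem4p9:
  fixes f :: "'a::euclidean_space \<Rightarrow> real"
    and B :: "'a \<Rightarrow> 'a dual"
    and \<mu> L \<eta> :: real
    and x d :: "nat \<Rightarrow> 'a"
    and H :: "nat \<Rightarrow> 'a dual \<Rightarrow> 'a"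
    and h :: "nat \<Rightarrow> real"
  defines "fstar \<equiv> (LEAST v. v \<in> range f)"
    and "\<kappa> \<equiv> L / \<mu>"
    and "\<psi>\<^sub>0 \<equiv> psi (\<lambda>u. L *\<^sub>R B u) (inv (H 0))"
  defines "\<zeta> \<equiv> (\<lambda>k::nat. exp (- \<psi>\<^sub>0 / real k))"
  assumes B: "self_adjoint_pos_def B"
    and f_diff: "\<And>y. f differentiable (at y)"
    and mu_pos: "\<mu> > 0"
    and L_pos: "L > 0"
    and strong: "\<And>y z. \<langle>grad f y - grad f z, y - z\<rangle> \<ge> \<mu> * (normB B (y - z))\<^sup>2"
    and lipschitz: "\<And>y z. dual_normB B (grad f y - grad f z) \<le> L * normB B (y - z)"
    and bfgs: "bfgs_method f x H d h"
    and eta_pos: "\<eta> > 0"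
    and step: "\<And>k. f (x k) - f (x (Suc k)) \<ge>
                 \<eta> * (\<langle>grad f (x k), d k\<rangle>\<^sup>2 / (L * (normB B (d k))\<^sup>2))"
  shows "\<forall>k\<ge>1. f (x k) - fstar \<le> (1 - 2 * \<eta> * \<kappa> powi (-2) * \<zeta> k) ^ k * (f (x 0) - fstar)"
proof (intro allI impI)
  fix k :: nat assume k: "k \<ge> 1"
  note convex = B f_diff mu_pos L_pos strong lipschitz
  interpret B: linear B by (rule spd_linear[OF B])
  define X where "X = (\<lambda>u. L *\<^sub>R B u)"
  have X: "self_adjoint_pos_def X" unfolding X_def by (rule spd_scaleR[OF B L_pos])
  have X_inv: "inv X s = (1 / L) *\<^sub>R inv B s" for s
    unfolding X_def by (rule spd_inv_scaleR[OF B L_pos])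
  define g where "g = (\<lambda>i. grad f (x i))"
  define \<delta> where "\<delta> = (\<lambda>i. x (Suc i) - x i)"
  define \<gamma> where "\<gamma> = (\<lambda>i. g (Suc i) - g i)"
  define G where "G = (\<lambda>i. inv (H i))"
  have H0: "self_adjoint_pos_def_dual (H 0)" and d: "\<And>i. d i = H i (g i)"
    and h: "\<And>i. h i > 0" and x: "\<And>i. x (Suc i) = x i - h i *\<^sub>R d i"
    and curv: "\<And>i. \<langle>\<gamma> i, \<delta> i\<rangle> > 0" and H: "\<And>i. H (Suc i) = bfgs_update (H i) (\<delta> i) (\<gamma> i)"
    using bfgs unfolding bfgs_method_def Let_def g_def \<delta>_def \<gamma>_def by blast+
  have update: "bij (H (Suc i))" "G (Suc i) = bfgs_inv_update (G i) (\<delta> i) (\<gamma> i)"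
    if "self_adjoint_pos_def (G i)" "bij (H i)" for i
    using bfgs_inv_update_inverse[OF that(1) curv that(2), of i] by (simp_all add: G_def H)
  \<comment> \<open>Both properties are carried together, since \<open>inv (H i)\<close> is a true
    inverse only while \<open>H i\<close> is bijective.\<close>
  have GH: "self_adjoint_pos_def (G i) \<and> bij (H i)" for i
  proof (induction i)
    case 0
    show ?case using spd_of_dual[OF H0] by (simp add: G_def)
  next
    case (Suc i)
    then show ?case using update[of i] bfgs_inv_update_spd[OF _ curv, of "G i" i] by simp
  qed
  then have G: "self_adjoint_pos_def (G i)" for i by blast
  have G_Suc: "G (Suc i) = bfgs_inv_update (G i) (\<delta> i) (\<gamma> i)" for i
    using update GH by blast
  have Gd: "G i (d i) = g i" for i
    using GH[of i] by (simp add: G_def d bij_is_inj)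
  have \<delta>: "\<delta> i = (- h i) *\<^sub>R d i" for i by (simp add: \<delta>_def x)
  \<comment> \<open>The curvature condition excludes null steps; hence no direction and no gradient
    vanishes.\<close>
  have "\<delta> i \<noteq> 0" for i using curv[of i] by auto
  then have d_nz: "d i \<noteq> 0" for i by (auto simp: \<delta>)
  have G\<delta>: "G i (\<delta> i) = (- h i) *\<^sub>R g i" for i
    using linear_scale[OF spd_linear[OF G], of i "- h i" "d i"] by (simp add: \<delta> Gd)
  have gd: "\<langle>g i, d i\<rangle> > 0" for i
    using spd_pos[OF G d_nz, of i i] by (simp add: Gd)
  have g_nz: "g i \<noteq> 0" for i using gd[of i] by auto

  define b e where "b = (\<lambda>i. \<langle>B (d i), d i\<rangle>)" and "e = (\<lambda>i. \<langle>g i, inv B (g i)\<rangle>)"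
  have b: "b i > 0" for i unfolding b_def by (rule spd_pos[OF B d_nz])
  have e: "e i > 0" for i unfolding e_def by (rule spd_inv_pos[OF B g_nz])
  text \<open>The squared cosine of the angle between the search direction and the gradient.\<close>
  define q where "q = (\<lambda>i. \<langle>g i, d i\<rangle>\<^sup>2 / (e i * b i))"
  have q: "q i > 0" for i using gd[of i] b[of i] e[of i] by (simp add: q_def)

  have potential: "ln (\<mu> / L / q i) \<le> psi X (G i) - psi X (G (Suc i))" for i
  proof -
    \<comment> \<open>The scaling of \<open>X\<close> by \<open>L\<close> makes cocoercivity bound
      this quotient by exactly \<open>1\<close>.\<close>
    have "\<langle>\<gamma> i, inv X (\<gamma> i)\<rangle> / \<langle>\<gamma> i, \<delta> i\<rangle> \<le> 1"
      using gradient_cocoercive[OF convex, of "x (Suc i)" "x i"] curv[of i] L_pos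
      by (simp add: X_inv blinfun.scaleR_right \<gamma>_def \<delta>_def g_def field_simps)
    moreover have "ln (\<mu> / L / q i)
        \<le> ln (\<langle>\<gamma> i, \<delta> i\<rangle> * \<langle>G i (\<delta> i), inv X (G i (\<delta> i))\<rangle> / \<langle>G i (\<delta> i), \<delta> i\<rangle>\<^sup>2)"
    proof -
      have "\<langle>\<gamma> i, \<delta> i\<rangle> \<ge> \<mu> * ((h i)\<^sup>2 * b i)"
        using strong_monotone[OF convex, of "\<delta> i" "x i"]
        by (simp add: \<gamma>_def g_def \<delta> x b_def B.scale B.neg blinfun.bilinear_simps power2_eq_square)
      moreover have "\<langle>G i (\<delta> i), inv X (G i (\<delta> i))\<rangle> = (h i)\<^sup>2 * e i / L"
        using linear_scale[OF spd_inv_linear[OF B], of "- h i" "g i"]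
        by (simp add: G\<delta> X_inv e_def blinfun.bilinear_simps power2_eq_square)
      moreover have "\<langle>G i (\<delta> i), \<delta> i\<rangle> = (h i)\<^sup>2 * \<langle>g i, d i\<rangle>"
        unfolding G\<delta> by (simp add: \<delta> blinfun.bilinear_simps power2_eq_square)
      \<comment> \<open>The fourth powers of \<open>h i\<close> cancel, so the potential drop is
        bounded independently of the step size.\<close>
      moreover have "\<mu> / L / q i
          = \<mu> * ((h i)\<^sup>2 * b i) * ((h i)\<^sup>2 * e i / L) / ((h i)\<^sup>2 * \<langle>g i, d i\<rangle>)\<^sup>2"
        using h[of i] gd[of i] L_pos e[of i] b[of i]
        by (simp add: q_def field_simps power2_eq_square)
      moreover have "(h i)\<^sup>2 * e i / L \<ge> 0" using e[of i] L_pos by simp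
      ultimately have "\<mu> / L / q i
          \<le> \<langle>\<gamma> i, \<delta> i\<rangle> * \<langle>G i (\<delta> i), inv X (G i (\<delta> i))\<rangle> / \<langle>G i (\<delta> i), \<delta> i\<rangle>\<^sup>2"
        by (simp only:) (intro divide_right_mono mult_right_mono zero_le_power2; assumption)
      moreover have "\<mu> / L / q i > 0" using mu_pos L_pos q[of i] by simp
      ultimately show ?thesis by (simp add: ln_mono)
    qed
    ultimately show ?thesis
      using psi_bfgs_inv_update[OF G curv X op_det_inv_spd_pos[OF X G], of i i]
      by (simp add: G_Suc)
  qed
  \<comment> \<open>The drops telescope, and nonnegativity of the last potential leaves only the
    initial one.\<close>
  have "(\<Sum>i<k. ln (\<mu> / L / q i)) \<le> psi X (G 0) - psi X (G k)"
  proof (induction k)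
    case (Suc n)
    then show ?case using potential[of n] by simp
  qed simp
  also have "\<dots> \<le> \<psi>\<^sub>0"
    using psi_nonneg[OF X G, of k] by (simp add: \<psi>\<^sub>0_def X_def G_def)
  finally have log_sum: "(\<Sum>i<k. ln (\<mu> / L / q i)) \<le> \<psi>\<^sub>0" .

  \<comment> \<open>Chosen so that gradient dominance turns \<open>c * q i\<close> times the gap
    into at most the decrease promised by the step condition.\<close>
  define c where "c = 2 * \<eta> * \<mu> / L"
  have progress: "f (x (Suc i)) - fstar \<le> (1 - c * q i) * (f (x i) - fstar)" for i
  proof -
    obtain m where m: "f m = fstar"
      using Least_range_attained[OF convex] by (auto simp: fstar_def)
    have "f (x i) - fstar \<le> e i / (2 * \<mu>)"
      using gradient_dominance[OF convex, of "x i" m] by (simp add: m e_def g_def)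
    then have "c * q i * (f (x i) - fstar) \<le> c * q i * (e i / (2 * \<mu>))"
      using q[of i] eta_pos mu_pos L_pos by (intro mult_left_mono) (simp_all add: c_def)
    also have "\<dots> = \<eta> * (\<langle>g i, d i\<rangle>\<^sup>2 / (L * b i))"
      using e[of i] mu_pos by (simp add: c_def q_def)
    also have "\<dots> \<le> f (x i) - f (x (Suc i))"
      using step[of i] by (simp add: g_def b_def normB_square[OF B])
    finally show ?thesis by (simp add: algebra_simps)
  qed
  have "f (x k) - fstar \<le> (1 - c * (\<mu> / L * exp (- \<psi>\<^sub>0 / real k))) ^ k * (f (x 0) - fstar)"
  proof (rule geometric_rate_of_log_sum[where \<epsilon> = "\<lambda>i. f (x i) - fstar" and q = q])
    show "f (x i) - fstar > 0" for i
      using not_minimal_if_grad_nonzero[OF convex, of "x i"] g_nz[of i]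
      by (simp add: fstar_def g_def)
    show "c > 0" "\<mu> / L > 0" using eta_pos mu_pos L_pos by (simp_all add: c_def)
  qed (use q progress log_sum k in auto)
  \<comment> \<open>One inverse factor of \<open>\<kappa>\<close> comes from \<open>c\<close>, the
    other from the bound on the mean squared cosine.\<close>
  also have "c * (\<mu> / L * exp (- \<psi>\<^sub>0 / real k)) = 2 * \<eta> * \<kappa> powi (-2) * \<zeta> k"
    using mu_pos L_pos
    by (simp add: c_def \<kappa>_def \<zeta>_def power_int_def power2_eq_square field_simps)
  finally show "f (x k) - fstar \<le> (1 - 2 * \<eta> * \<kappa> powi (-2) * \<zeta> k) ^ k * (f (x 0) - fstar)" .
qed

end
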